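(* A sequence $\{X_n\}$ of integer-valued random variables defines a marginally stationary AR(1) sequence with $0<\rho<1$ if $X_n$ is discrete SSD($\rho$).
   Context: PGF means probability generating function of a distribution on $\{0,1,2,\ldots\}$. A PGF is infinitely divisible (ID) if for every integer $n\ge 1$ it is the $n$-th power of some PGF. An integer-valued distribution on $\{0,1,2,\ldots\}$ with PGF $P(s)$ is discrete semi-selfdecomposable, written discrete SSD($c$), if there exists a PGF $P_o(s)$ that is ID such that $P(s)=P(1-c+cs)\,P_o(s)$, for some $0<c<1$ and for all $s\in(0,1)$. A random variable is discrete SSD($c$) if its distribution is. In terms of PGFs, a marginally stationary integer-valued AR(1) sequence $\{X_n\}$ with innovations $\{\varepsilon_n\}$ is represented by $P(s)=P(1-\rho+\rho s)\,P_\varepsilon(s)$ for some $0<\rho<1$, where $P$ is the common PGF of the $X_n$ and $P_\varepsilon$ is the PGF of the innovations. *)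

theory Defs
  imports "HOL-Probability.Probability"
begin

text \<open>
  Distributions on \<open>{0,1,2,\<dots>}\<close> are probability measures on \<open>count_space (UNIV :: nat set)\<close>:
  the law of a random variable is a \<open>distr\<close>, and an existentially quantified distribution is a
  \<open>nat pmf\<close>, coerced by \<open>measure_pmf\<close>. PGFs are used on their common domain \<open>-1 \<le> s \<le> 1\<close>.
\<close>

definition law :: "'a measure \<Rightarrow> ('a \<Rightarrow> nat) \<Rightarrow> nat measure" where
  "law M X = distr M (count_space UNIV) X"

definition pgf :: "nat measure \<Rightarrow> real \<Rightarrow> real" where
  "pgf D s = (\<integral>k. s ^ k \<partial>D)"

definition is_PGF :: "(real \<Rightarrow> real) \<Rightarrow> bool" where
  "is_PGF P \<longleftrightarrow> (\<exists>p :: nat pmf. \<forall>s\<in>{-1..1}. P s = pgf p s)"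

definition ID_PGF :: "(real \<Rightarrow> real) \<Rightarrow> bool" where
  "ID_PGF P \<longleftrightarrow> is_PGF P \<and>
     (\<forall>n::nat. n \<ge> 1 \<longrightarrow> (\<exists>Q. is_PGF Q \<and> (\<forall>s\<in>{-1..1}. P s = Q s ^ n)))"

definition discrete_SSD :: "real \<Rightarrow> nat measure \<Rightarrow> bool" where
  "discrete_SSD c D \<longleftrightarrow> 0 < c \<and> c < 1 \<and>
     (\<exists>P\<^sub>o. ID_PGF P\<^sub>o \<and>
        (\<forall>s\<in>{0<..<1}. pgf D s = pgf D (1 - c + c * s) * P\<^sub>o s))"

text \<open>
  The PGF representation constrains only the marginal laws, so it imposes no joint law of \<open>X\<close>
  and \<open>\<epsilon>\<close>. The innovations may live on a space \<open>N\<close> of their own, since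
  \<open>M\<close> need not be rich enough to carry them.
\<close>

definition AR1_with_innovations ::
  "real \<Rightarrow> 'a measure \<Rightarrow> (nat \<Rightarrow> 'a \<Rightarrow> nat) \<Rightarrow> 'b measure \<Rightarrow> (nat \<Rightarrow> 'b \<Rightarrow> nat) \<Rightarrow> bool" where
  "AR1_with_innovations \<rho> M X N \<epsilon> \<longleftrightarrow>
     0 < \<rho> \<and> \<rho> < 1 \<and>
     prob_space M \<and> (\<forall>n. X n \<in> measurable M (count_space UNIV)) \<and>
     prob_space N \<and> prob_space.indep_vars N (\<lambda>_. count_space UNIV) \<epsilon> UNIV \<and>
     (\<exists>P P\<^sub>\<epsilon>. (\<forall>n. \<forall>s\<in>{-1..1}. pgf (law M (X n)) s = P s) \<and>
             (\<forall>n. \<forall>s\<in>{-1..1}. pgf (law N (\<epsilon> n)) s = P\<^sub>\<epsilon> s) \<and>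
             (\<forall>s\<in>{-1..1}. P s = P (1 - \<rho> + \<rho> * s) * P\<^sub>\<epsilon> s))"

text \<open>The sequence space \<open>nat \<Rightarrow> nat\<close> carries every sequence of laws on \<open>nat\<close>, so fixing the
  type of \<open>N\<close> loses no generality.\<close>

definition marginally_stationary_AR1 :: "real \<Rightarrow> 'a measure \<Rightarrow> (nat \<Rightarrow> 'a \<Rightarrow> nat) \<Rightarrow> bool" where
  "marginally_stationary_AR1 \<rho> M X \<longleftrightarrow>
     (\<exists>(N :: (nat \<Rightarrow> nat) measure) \<epsilon>. AR1_with_innovations \<rho> M X N \<epsilon>)"

end

theory Submission imports Defs "HOL-Complex_Analysis.Complex_Analysis" begin

text \<open>
  The innovations are i.i.d. with the distribution whose PGF is the factor \<open>P\<^sub>o\<close> of the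
  semi-selfdecomposability equation; such a sequence is supplied by the coordinates of an infinite
  product of copies of that distribution. Marginal stationarity then asks for
  \<open>P s = P (1 - \<rho> + \<rho> * s) * P\<^sub>o s\<close> on all of \<open>[-1, 1]\<close>, whereas semi-selfdecomposability
  provides it only on \<open>(0, 1)\<close>.

  The gap is closed by complex analysis. A PGF extends to a power series with nonnegative
  coefficients of sum 1, which converges uniformly on the closed unit disc; it is thus holomorphic
  on the open disc and continuous on the closed one. The affine map \<open>z \<mapsto> 1 - \<rho> + \<rho> * z\<close> takes
  either disc to itself, being a convex combination of \<open>z\<close> with the point 1. Hence both sides of
  the equation are holomorphic on the open disc; they agree on an interval, so they agree on the
  open disc by the identity theorem, and on the closed disc by continuity.
\<close>

section \<open>Generating functions on the closed unit disc\<close>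

definition complex_pgf :: "nat pmf \<Rightarrow> complex \<Rightarrow> complex" where
  "complex_pgf p z = (\<Sum>k. complex_of_real (pmf p k) * z ^ k)"

lemma summable_pmf_nat: "summable (pmf (p :: nat pmf))"
  using integrable_pmf[of UNIV p] by (simp add: integrable_count_space_nat_iff)

lemma norm_pmf_power_le:
  fixes z :: "'a :: real_normed_field"
  assumes "norm z \<le> 1"
  shows "norm (of_real (pmf p k) * z ^ k) \<le> pmf p k"
  using assms by (simp add: norm_mult norm_power mult_left_le power_le_one)

lemma complex_pgf_sums:
  assumes "norm z \<le> 1"
  shows "(\<lambda>k. complex_of_real (pmf p k) * z ^ k) sums complex_pgf p z"
  unfolding complex_pgf_def
  by (intro summable_sums summable_comparison_test'[OF summable_pmf_nat[of p], of 0]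
      norm_pmf_power_le assms)

lemma pgf_sums:
  fixes p :: "nat pmf"
  assumes "\<bar>s\<bar> \<le> 1"
  shows "(\<lambda>k. pmf p k * s ^ k) sums pgf p s"
proof -
  have bound: "norm (pmf p k * s ^ k) \<le> pmf p k" for k
    using norm_pmf_power_le[of s p k] assms by simp
  have "summable (\<lambda>k. norm (pmf p k * s ^ k))"
    by (rule summable_comparison_test'[OF summable_pmf_nat[of p], of 0]) (use bound in simp)
  then have "integrable (count_space UNIV) (\<lambda>k. pmf p k * s ^ k)"
    by (simp only: integrable_count_space_nat_iff)
  then have "(\<lambda>k. pmf p k * s ^ k) sums (\<integral>k. pmf p k * s ^ k \<partial>count_space UNIV)"
    by (rule sums_integral_count_space_nat)
  also have "(\<integral>k. pmf p k * s ^ k \<partial>count_space UNIV) = pgf p s"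
    by (simp add: pgf_def measure_pmf_eq_density integral_density)
  finally show ?thesis .
qed

lemma complex_pgf_of_real:
  assumes "\<bar>s\<bar> \<le> 1"
  shows "complex_pgf p (of_real s) = of_real (pgf p s)"
proof (rule sums_unique2)
  show "(\<lambda>k. complex_of_real (pmf p k) * of_real s ^ k) sums complex_pgf p (of_real s)"
    using assms by (intro complex_pgf_sums) simp
  show "(\<lambda>k. complex_of_real (pmf p k) * of_real s ^ k) sums of_real (pgf p s)"
    using sums_of_real[OF pgf_sums[OF assms, of p], where 'a = complex] by simp
qed

lemma holomorphic_complex_pgf: "complex_pgf p holomorphic_on ball 0 1"
  by (rule power_series_holomorphic[where a = "\<lambda>k. of_real (pmf p k)"])
    (auto intro!: complex_pgf_sums)

text \<open>
  Holomorphy says nothing on the unit circle. Continuity there comes from the summable majorant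
  \<open>pmf p\<close>, which makes the partial sums converge uniformly on the closed disc.
\<close>

lemma continuous_on_complex_pgf: "continuous_on (cball 0 1) (complex_pgf p)"
proof (rule uniform_limit_theorem)
  show "uniform_limit (cball 0 1) (\<lambda>n z. \<Sum>k<n. complex_of_real (pmf p k) * z ^ k)
          (complex_pgf p) sequentially"
    unfolding complex_pgf_def[abs_def]
    by (rule Weierstrass_m_test[OF _ summable_pmf_nat[of p]], rule norm_pmf_power_le) simp
  show "\<forall>\<^sub>F n in sequentially.
          continuous_on (cball 0 1) (\<lambda>z. \<Sum>k<n. complex_of_real (pmf p k) * z ^ k)"
    by (intro always_eventually allI continuous_intros)
qed simp

section \<open>Extending the functional equation\<close>

lemma norm_convex_comb_one:
  fixes z :: complex
  assumes "0 < c" "c < 1"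
  shows "norm (1 - of_real c + of_real c * z) \<le> 1 - c + c * norm z"
proof -
  have "norm (complex_of_real (1 - c) + of_real c * z) \<le> \<bar>1 - c\<bar> + \<bar>c\<bar> * norm z"
    using norm_triangle_ineq[of "complex_of_real (1 - c)" "of_real c * z"]
    unfolding norm_mult norm_of_real .
  then show ?thesis using assms by simp
qed

text \<open>
  The identity theorem needs an accumulation point of the interval inside the open disc, and 1/2
  is one. It cannot reach \<open>s = -1\<close> and \<open>s = 1\<close>, which lie on the unit circle; these are limits of
  points of the open disc.
\<close>

lemma pgf_functional_equation_extend:
  fixes p q :: "nat pmf"
  assumes c: "0 < c" "c < 1"
    and eq: "\<And>s. s \<in> {0<..<1} \<Longrightarrow> pgf p s = pgf p (1 - c + c * s) * pgf q s"
    and s: "s \<in> {-1..1}"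
  shows "pgf p s = pgf p (1 - c + c * s) * pgf q s"
proof -
  define h where "h z = 1 - complex_of_real c + of_real c * z" for z
  define f where "f z = complex_pgf p z - complex_pgf p (h z) * complex_pgf q z" for z
  have h_ball: "h ` ball 0 1 \<subseteq> ball 0 1"
  proof safe
    fix z :: complex assume "z \<in> ball 0 1"
    then have "c * norm z < c * 1" using c by (intro mult_strict_left_mono) auto
    then show "h z \<in> ball 0 1"
      using norm_convex_comb_one[OF c, of z] by (simp add: h_def)
  qed
  have h_cball: "h ` cball 0 1 \<subseteq> cball 0 1"
  proof safe
    fix z :: complex assume "z \<in> cball 0 1"
    then have "c * norm z \<le> c * 1" using c by (intro mult_left_mono) auto
    then show "h z \<in> cball 0 1"
      using norm_convex_comb_one[OF c, of z] by (simp add: h_def)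
  qed
  have f_of_real: "f (of_real t) = of_real (pgf p t - pgf p (1 - c + c * t) * pgf q t)"
    if "t \<in> {-1..1}" for t
  proof -
    have t: "\<bar>t\<bar> \<le> 1" using that by auto
    have h: "h (of_real t) = of_real (1 - c + c * t)"
      by (simp add: h_def)
    have "of_real t \<in> cball (0 :: complex) 1" using t by simp
    then have "h (of_real t) \<in> cball 0 1" using h_cball by blast
    then have "\<bar>1 - c + c * t\<bar> \<le> 1"
      unfolding h mem_cball_0 norm_of_real .
    with t show ?thesis
      unfolding f_def h by (simp only: complex_pgf_of_real of_real_diff of_real_mult)
  qed
  have holo: "f holomorphic_on ball 0 1"
  proof -
    have "(complex_pgf p \<circ> h) holomorphic_on ball 0 1"
      by (rule holomorphic_on_compose_gen[OF _ holomorphic_complex_pgf h_ball])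
        (auto simp: h_def[abs_def] intro!: holomorphic_intros)
    then show ?thesis
      unfolding f_def[abs_def] comp_def by (intro holomorphic_intros holomorphic_complex_pgf)
  qed
  have accum: "(1/2 :: complex) islimpt of_real ` {0<..<1}"
  proof -
    have "(1/2 :: real) islimpt {0<..<1}"
      by (intro interior_limit_point) (simp add: interior_open)
    then have "(of_real (1/2) :: complex) islimpt of_real ` {0<..<1}"
      by (rule islimpt_isCont_image)
        (simp_all only: of_real_eq_iff eventually_neq_at_within continuous_of_real continuous_ident)
    then show ?thesis by simp
  qed
  have f_interval: "f z = 0" if "z \<in> of_real ` {0<..<1}" for z
    using that eq by (auto simp: f_of_real)
  have f_ball: "f z = 0" if "z \<in> ball 0 1" for z
    using holo open_ball connected_ball _ _ accum f_interval that
    by (rule analytic_continuation) (auto simp: norm_divide)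
  have "continuous_on (closure (ball 0 1)) f"
  proof -
    have "continuous_on (cball 0 1) (\<lambda>z. complex_pgf p (h z))"
      by (rule continuous_on_compose2[OF continuous_on_complex_pgf _ h_cball])
        (auto simp: h_def intro!: continuous_intros)
    then have "continuous_on (cball 0 1) f"
      unfolding f_def by (intro continuous_intros continuous_on_complex_pgf)
    then show ?thesis by simp
  qed
  moreover have "complex_of_real s \<in> closure (ball 0 1)"
    using s by auto
  ultimately have "f (of_real s) = 0"
    using f_ball by (metis continuous_constant_on_closure)
  then show ?thesis
    unfolding f_of_real[OF s] of_real_eq_0_iff by simp
qed

section \<open>Realizing distributions\<close>

text \<open>A probability measure on a countable type is discrete, hence a \<open>pmf\<close>; this gives the law the
  coefficient sequence that the power series argument needs.\<close>

lemma law_eq_pmf: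
  assumes "prob_space M" "X \<in> measurable M (count_space UNIV)"
  obtains p :: "nat pmf" where "law M X = measure_pmf p"
proof -
  interpret D: prob_space "law M X"
    unfolding law_def using assms by (rule prob_space.prob_space_distr)
  have sets: "sets (law M X) = UNIV"
    by (simp add: law_def)
  moreover have "AE x in law M X. measure (law M X) {x} \<noteq> 0"
    unfolding D.AE_support_countable[OF sets] by (auto intro!: exI[of _ UNIV])
  ultimately have "law M X = measure_pmf (Abs_pmf (law M X))"
    using D.prob_space_axioms by (simp add: Abs_pmf_inverse)
  then show thesis by (rule that)
qed

lemma iid_sequence_exists:
  fixes p :: "nat pmf"
  obtains N :: "(nat \<Rightarrow> nat) measure" and \<epsilon> :: "nat \<Rightarrow> (nat \<Rightarrow> nat) \<Rightarrow> nat"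
  where "prob_space N" "prob_space.indep_vars N (\<lambda>_. count_space UNIV) \<epsilon> UNIV"
    "\<And>n. law N (\<epsilon> n) = measure_pmf p"
proof -
  define N where "N = Pi\<^sub>M (UNIV :: nat set) (\<lambda>_. measure_pmf p)"
  define \<epsilon> where "\<epsilon> n \<omega> = \<omega> n" for n :: nat and \<omega> :: "nat \<Rightarrow> nat"
  interpret N: prob_space N
    unfolding N_def by (intro prob_space_PiM measure_pmf.prob_space_axioms)
  have law: "law N (\<epsilon> n) = measure_pmf p" for n
  proof -
    have "law N (\<epsilon> n) = distr N (measure_pmf p) (\<lambda>\<omega>. \<omega> n)"
      unfolding law_def \<epsilon>_def by (intro distr_cong) simp_all
    also have "\<dots> = measure_pmf p"
      unfolding N_def by (intro distr_PiM_component measure_pmf.prob_space_axioms) simp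
    finally show ?thesis .
  qed
  have sets_N: "sets N = sets (Pi\<^sub>M UNIV (\<lambda>_. count_space UNIV))"
    unfolding N_def by (intro sets_PiM_cong) simp_all
  have meas: "\<epsilon> n \<in> measurable N (count_space UNIV)" for n
    unfolding \<epsilon>_def measurable_cong_sets[OF sets_N refl] by measurable
  \<comment> \<open>Independence means that the joint law is the product of the marginals. The joint law of all
    coordinates is \<open>N\<close> itself, which was built as such a product.\<close>
  have "N.indep_vars (\<lambda>_. count_space UNIV) \<epsilon> UNIV"
  proof (subst N.indep_vars_iff_distr_eq_PiM)
    have "distr N (Pi\<^sub>M UNIV (\<lambda>_. count_space UNIV)) (\<lambda>\<omega>. \<lambda>i\<in>UNIV. \<epsilon> i \<omega>) = distr N N (\<lambda>\<omega>. \<omega>)"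
      using sets_N by (intro distr_cong) (auto simp: \<epsilon>_def)
    also have "\<dots> = Pi\<^sub>M UNIV (\<lambda>i. distr N (count_space UNIV) (\<epsilon> i))"
      using law by (simp add: law_def N_def)
    finally show "distr N (Pi\<^sub>M UNIV (\<lambda>_. count_space UNIV)) (\<lambda>\<omega>. \<lambda>i\<in>UNIV. \<epsilon> i \<omega>) =
      Pi\<^sub>M UNIV (\<lambda>i. distr N (count_space UNIV) (\<epsilon> i))" .
  qed (use meas in auto)
  with N.prob_space_axioms show thesis
    using law by (rule that)
qed

section \<open>Semi-selfdecomposable marginals\<close>

theorem mainTheorem3:
  fixes M :: "'a measure" and X :: "nat \<Rightarrow> 'a \<Rightarrow> nat" and \<rho> :: real
  assumes "prob_space M"
    and "\<And>n. X n \<in> measurable M (count_space UNIV)"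
    and "\<And>m n. law M (X m) = law M (X n)"
    and "\<And>n. discrete_SSD \<rho> (law M (X n))"
  shows "marginally_stationary_AR1 \<rho> M X"
proof -
  obtain q :: "nat pmf" where q: "law M (X 0) = measure_pmf q"
    using law_eq_pmf assms(1,2) by blast
  have law_X: "law M (X n) = measure_pmf q" for n
    using assms(3)[of n 0] q by simp
  obtain P\<^sub>o where \<rho>: "0 < \<rho>" "\<rho> < 1" and "ID_PGF P\<^sub>o"
    and P\<^sub>o: "\<And>s. s \<in> {0<..<1} \<Longrightarrow> pgf q s = pgf q (1 - \<rho> + \<rho> * s) * P\<^sub>o s"
    using assms(4)[of 0] unfolding q discrete_SSD_def by blast
  then obtain p :: "nat pmf" where p: "\<And>s. s \<in> {-1..1} \<Longrightarrow> P\<^sub>o s = pgf p s"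
    unfolding ID_PGF_def is_PGF_def by blast
  have "pgf q s = pgf q (1 - \<rho> + \<rho> * s) * pgf p s" if "s \<in> {0<..<1}" for s
    using P\<^sub>o[OF that] p[of s] that by simp
  then have eq: "\<forall>s\<in>{-1..1}. pgf q s = pgf q (1 - \<rho> + \<rho> * s) * pgf p s"
    using pgf_functional_equation_extend[OF \<rho>] by blast
  obtain N :: "(nat \<Rightarrow> nat) measure" and \<epsilon> :: "nat \<Rightarrow> (nat \<Rightarrow> nat) \<Rightarrow> nat"
    where N: "prob_space N"
    "prob_space.indep_vars N (\<lambda>_. count_space UNIV) \<epsilon> UNIV"
    and law_\<epsilon>: "\<And>n. law N (\<epsilon> n) = measure_pmf p"
    using iid_sequence_exists by blast
  have "AR1_with_innovations \<rho> M X N \<epsilon>"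
    unfolding AR1_with_innovations_def law_X law_\<epsilon>
    using \<rho> assms(1,2) N eq by blast
  then show ?thesis
    unfolding marginally_stationary_AR1_def by blast
qed

end
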